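(* Let $n > 3$ be an integer and let $A_1, \dots, A_n$ be $n$ distinct points in the Euclidean plane such that no three of them lie on one straight line and the distance between every two of them is a natural number. Then each of these distances is greater than $1$.
   Context: Natural numbers are the positive integers. *)

theory Defs
  imports "HOL-Analysis.Analysis"
begin

end

theory Submission
  imports Defs
begin

text \<open>If two of the points are at distance 1, the strict triangle inequality forces every other
  point to be at equal integral distances from both, hence to lie on their perpendicular bisector.
  Two such points at distances \<open>a\<close>, \<open>b\<close> have signed heights \<open>u/2\<close>, \<open>v/2\<close> over the segment, where
  \<open>u\<^sup>2 = 4a\<^sup>2 - 1\<close> and \<open>v\<^sup>2 = 4b\<^sup>2 - 1\<close>. If \<open>u - v\<close> is a nonzero integer then \<open>u\<close> is rational,
  so \<open>4a\<^sup>2 - 1\<close> is a perfect square, which is impossible modulo 4.\<close>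

lemma square_neq_four_times_minus_one:
  fixes k m :: int
  shows "k\<^sup>2 \<noteq> 4 * m - 1"
proof
  assume k: "k\<^sup>2 = 4 * m - 1"
  show False
  proof (cases "even k")
    case True
    then obtain j where "k = 2 * j" ..
    with k have "4 * j\<^sup>2 = 4 * m - 1" by (simp add: power_mult_distrib)
    then show False by presburger
  next
    case False
    then obtain j where "k = 2 * j + 1" by (rule oddE)
    with k have "4 * (j\<^sup>2 + j) + 1 = 4 * m - 1" by (simp add: power2_eq_square algebra_simps)
    then show False by presburger
  qed
qed

text \<open>The squares of \<open>u\<close>, \<open>v\<close> and \<open>u - v\<close> determine
  \<open>(u - v) * u\<close>, and here make it an integer. Assuming only the square of
  \<open>u - v\<close> leaves open which of \<open>u\<close>, \<open>v\<close> is larger.\<close>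

lemma sqrt_four_square_minus_one_diff_not_integral:
  fixes u v :: real and a b d :: int
  assumes u: "u\<^sup>2 = 4 * of_int a ^ 2 - 1" and v: "v\<^sup>2 = 4 * of_int b ^ 2 - 1"
    and uv: "(u - v)\<^sup>2 = 4 * of_int d ^ 2"
  shows "d = 0"
proof (rule ccontr)
  assume "d \<noteq> 0"
  \<comment> \<open>From \<open>2 * (u - v) * u = (u - v)\<^sup>2 + u\<^sup>2 - v\<^sup>2\<close>.
    Since \<open>u - v\<close> is \<open>2 * d\<close> up to sign, \<open>u\<close> is
    \<open>M / d\<close> up to sign.\<close>
  define M where "M = d\<^sup>2 + a\<^sup>2 - b\<^sup>2"
  have M: "(u - v) * u = 2 * of_int M"
    using u v uv by (simp add: M_def power2_eq_square algebra_simps)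
  have "4 * of_int M ^ 2 = ((u - v) * u)\<^sup>2"
    by (simp add: M power_mult_distrib)
  also have "\<dots> = 4 * of_int d ^ 2 * (4 * of_int a ^ 2 - 1)"
    by (simp only: power_mult_distrib u uv)
  finally have "real_of_int (M\<^sup>2) = of_int (d\<^sup>2 * (4 * a\<^sup>2 - 1))" by simp
  then have eq: "M\<^sup>2 = d\<^sup>2 * (4 * a\<^sup>2 - 1)" by (simp only: of_int_eq_iff)
  then have "d\<^sup>2 dvd M\<^sup>2" by simp
  then have "d dvd M" by simp
  then obtain k where "M = d * k" ..
  with eq \<open>d \<noteq> 0\<close> have "k\<^sup>2 = 4 * a\<^sup>2 - 1" by (simp add: power_mult_distrib)
  then show False using square_neq_four_times_minus_one by blast
qed

lemma dist_power2_real2: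
  fixes x y :: "real ^ 2"
  shows "(dist x y)\<^sup>2 = (x $ 1 - y $ 1)\<^sup>2 + (x $ 2 - y $ 2)\<^sup>2"
  unfolding dist_norm power2_norm_eq_inner
  by (simp add: inner_vec_def sum_2 power2_eq_square)

text \<open>Equality in a triangle inequality would put one point between the other two. So both
  inequalities are strict, and the integers \<open>a\<close> and \<open>b\<close> differ by less
  than 1.\<close>

lemma dist_eq_if_unit_integral_not_collinear:
  fixes p q x :: "'a::euclidean_space" and a b :: nat
  assumes "dist p q = 1" "dist x p = real a" "dist x q = real b" "\<not> collinear {p, q, x}"
  shows "a = b"
proof -
  have "dist x p \<noteq> dist x q + dist q p" "dist x q \<noteq> dist x p + dist p q"
    using assms(4) between_imp_collinear[of x p q] between_imp_collinear[of x q p]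
    by (auto simp: between insert_commute)
  moreover have "dist x p \<le> dist x q + dist q p" "dist x q \<le> dist x p + dist p q"
    by (rule dist_triangle)+
  ultimately show ?thesis using assms(1-3) by (simp add: dist_commute)
qed

lemma integral_dist_apexes_eq:
  fixes p q x y :: "real ^ 2" and a b d :: nat
  assumes pq: "dist p q = 1"
    and x: "dist x p = real a" "dist x q = real a"
    and y: "dist y p = real b" "dist y q = real b"
    and xy: "dist x y = real d"
  shows "x = y"
proof -
  define c s where "c = q $ 1 - p $ 1" and "s = q $ 2 - p $ 2"
  have cs: "c\<^sup>2 + s\<^sup>2 = 1"
    using dist_power2_real2[of q p] pq by (simp add: c_def s_def dist_commute)
  \<comment> \<open>\<open>t\<close> and \<open>h\<close> are coordinates in the orthonormal frame
    with origin \<open>p\<close> and first axis towards \<open>q\<close>: position along the segment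
    and signed height over it.\<close>
  define h where "h z = c * (z $ 2 - p $ 2) - s * (z $ 1 - p $ 1)" for z :: "real ^ 2"
  define t where "t z = c * (z $ 1 - p $ 1) + s * (z $ 2 - p $ 2)" for z :: "real ^ 2"
  have t: "t z = 1 / 2" if "dist z p = dist z q" for z
  proof -
    have "(dist z p)\<^sup>2 - (dist z q)\<^sup>2 = 2 * t z - (c\<^sup>2 + s\<^sup>2)"
      unfolding dist_power2_real2 t_def c_def s_def by (simp add: power2_eq_square algebra_simps)
    then show ?thesis using that cs by simp
  qed
  have isometry: "(h z - h w)\<^sup>2 + (t z - t w)\<^sup>2 = (dist z w)\<^sup>2" for z w
  proof -
    \<comment> \<open>The Brahmagupta-Fibonacci identity for a product of two sums of two
      squares.\<close>
    have "(h z - h w)\<^sup>2 + (t z - t w)\<^sup>2 = (c\<^sup>2 + s\<^sup>2) * (dist z w)\<^sup>2"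
      unfolding dist_power2_real2 t_def h_def by (simp add: power2_eq_square algebra_simps)
    then show ?thesis using cs by simp
  qed
  have h: "(2 * h z)\<^sup>2 = 4 * (dist z p)\<^sup>2 - 1" if "dist z p = dist z q" for z
  proof -
    have "h p = 0" "t p = 0" by (simp_all add: h_def t_def)
    then show ?thesis
      using isometry[of z p] t[OF that] by (simp add: power_mult_distrib power_divide)
  qed
  \<comment> \<open>Both \<open>t\<close> values are 1/2, so only the heights contribute to the
    distance.\<close>
  have "(2 * h x - 2 * h y)\<^sup>2 = 4 * (dist x y)\<^sup>2"
    using isometry[of x y] t[of x] t[of y] x y by (simp add: power2_eq_square algebra_simps)
  then have "int d = 0"
    using sqrt_four_square_minus_one_diff_not_integral[of "2 * h x" "int a" "2 * h y" "int b" "int d"]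
      h[of x] h[of y] x y xy by simp
  then show ?thesis using xy by simp
qed

theorem theorem2:
  fixes n :: nat and A :: "nat \<Rightarrow> real ^ 2"
  assumes "n > 3"
    and "inj_on A {1..n}"
    and "\<And>i j k. \<lbrakk>i \<in> {1..n}; j \<in> {1..n}; k \<in> {1..n}; i \<noteq> j; i \<noteq> k; j \<noteq> k\<rbrakk>
            \<Longrightarrow> \<not> collinear {A i, A j, A k}"
    and "\<And>i j. \<lbrakk>i \<in> {1..n}; j \<in> {1..n}; i \<noteq> j\<rbrakk>
            \<Longrightarrow> \<exists>m::nat. m > 0 \<and> dist (A i) (A j) = real m"
  shows "\<forall>i\<in>{1..n}. \<forall>j\<in>{1..n}. i \<noteq> j \<longrightarrow> dist (A i) (A j) > 1"
proof (intro ballI impI, rule ccontr)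
  fix i j
  assume ij: "i \<in> {1..n}" "j \<in> {1..n}" "i \<noteq> j" and "\<not> dist (A i) (A j) > 1"
  with assms(4)[OF ij] have unit: "dist (A i) (A j) = 1" by auto
  \<comment> \<open>As \<open>n > 3\<close>, at least two further points remain; both turn out to be
    apexes over the unit segment, which forces them to coincide.\<close>
  have "card ({1..n} - {i, j}) = n - 2"
    using ij by (simp add: card_Diff_subset)
  then have "2 \<le> card ({1..n} - {i, j})" using assms(1) by simp
  then obtain S where "S \<subseteq> {1..n} - {i, j}" "card S = 2"
    by (rule obtain_subset_with_card_n)
  then obtain k l where kl: "k \<in> {1..n} - {i, j}" "l \<in> {1..n} - {i, j}" "k \<noteq> l"
    by (auto simp: card_2_iff)
  have apex: "\<exists>a::nat. dist (A m) (A i) = real a \<and> dist (A m) (A j) = real a"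
    if m: "m \<in> {1..n} - {i, j}" for m
  proof -
    obtain a b :: nat where ab: "dist (A m) (A i) = real a" "dist (A m) (A j) = real b"
      using assms(4)[of m i] assms(4)[of m j] m ij by auto
    moreover have "\<not> collinear {A i, A j, A m}" using assms(3)[of i j m] ij m by auto
    ultimately show ?thesis
      using dist_eq_if_unit_integral_not_collinear[OF unit ab] by auto
  qed
  obtain d :: nat where "dist (A k) (A l) = real d"
    using assms(4)[of k l] kl by auto
  with apex[OF kl(1)] apex[OF kl(2)] have "A k = A l"
    using integral_dist_apexes_eq[OF unit] by blast
  then show False using assms(2) kl by (auto dest: inj_onD)
qed

end
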